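(* Let $(\mathbf{C},\mathcal{M})$ satisfy the standing assumptions of the context. Consider $\mathcal{M}$-morphisms $a_1:A\to B_1$, $a_2:A\to B_2$ with pushout $B_1\xrightarrow{d_1}D\xleftarrow{d_2}B_2$, and $\mathcal{M}$-morphisms $e_1:B_1\to E$, $e_2:B_2\to E$ with $e_1\circ a_1=e_2\circ a_2$; let $e:D\to E$ be the induced morphism ($e\circ d_j=e_j$). Let $B_1\xleftarrow{b_1}X\xrightarrow{b_2}B_2$ be the pullback of $B_1\xrightarrow{e_1}E\xleftarrow{e_2}B_2$ and $x:A\to X$ the induced morphism. Then $e$ is an epimorphism if and only if the square formed by $b_1,b_2,e_1,e_2$ (with $e_1 b_1=e_2 b_2$) is a pushout.
   Context: Standing assumptions: $\mathbf{C}$ is a category and $\mathcal{M}$ a class of monomorphisms such that $(\mathbf{C},\mathcal{M})$ is $\mathcal{M}$-adhesive: $\mathcal{M}$ contains all isomorphisms and is closed under composition and decomposition ($g\circ f\in\mathcal{M}$ and $g\in\mathcal{M}$ imply $f\in\mathcal{M}$); pushouts of spans and pullbacks of cospans with at least one leg in $\mathcal{M}$ exist; $\mathcal{M}$ is stable under pushout and pullback; pushouts along $\mathcal{M}$-morphisms are $\mathcal{M}$-van Kampen squares (in a commutative cube whose bottom face is a pushout along an $\mathcal{M}$-morphism, whose back faces are pullbacks and whose vertical morphisms other than the one into the source corner of the bottom square are in $\mathcal{M}$, the top face is a pushout iff the front faces are pullbacks). Further, $\mathbf{C}$ has epi-$\mathcal{M}$-factorizations (every morphism is $m\circ e$ with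 $e$ epi, $m\in\mathcal{M}$, unique up to iso), is balanced (morphisms that are mono and epi are isos), has a strict $\mathcal{M}$-initial object (an object $\varnothing$ with a unique monomorphism $\varnothing\to A$, lying in $\mathcal{M}$, for every $A$, and such that every morphism $Y\to\varnothing$ is an iso), and has $\mathcal{M}$-effective unions: whenever $B\xleftarrow{b'}A\xrightarrow{c'}C$ are $\mathcal{M}$-morphisms with pushout $D$ and $b:B\to E$, $c:C\to E$ are $\mathcal{M}$-morphisms with $b b'=c c'$ forming a pullback square, the induced morphism $D\to E$ is in $\mathcal{M}$. *)

theory Defs
  imports Main
begin

record ('o, 'a) category_data =
  Obj :: "'o set"
  Arr :: "'a set"
  Dom :: "'a \<Rightarrow> 'o"
  Cod :: "'a \<Rightarrow> 'o"
  Id :: "'o \<Rightarrow> 'a"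
  Comp :: "'a \<Rightarrow> 'a \<Rightarrow> 'a"  (infixr "\<cdot>\<index>" 70)

definition hom :: "('o, 'a, 'r) category_data_scheme \<Rightarrow> 'o \<Rightarrow> 'o \<Rightarrow> 'a set" where
  "hom C X Y = {f \<in> Arr C. Dom C f = X \<and> Cod C f = Y}"

locale category =
  fixes C :: "('o, 'a, 'r) category_data_scheme" (structure)
  assumes dom_obj: "f \<in> Arr C \<Longrightarrow> Dom C f \<in> Obj C"
    and cod_obj: "f \<in> Arr C \<Longrightarrow> Cod C f \<in> Obj C"
    and id_hom: "X \<in> Obj C \<Longrightarrow> Id C X \<in> hom C X X"
    and comp_hom: "f \<in> hom C X Y \<Longrightarrow> g \<in> hom C Y Z \<Longrightarrow> g \<cdot> f \<in> hom C X Z"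
    and comp_id_right: "f \<in> hom C X Y \<Longrightarrow> f \<cdot> Id C X = f"
    and comp_id_left: "f \<in> hom C X Y \<Longrightarrow> Id C Y \<cdot> f = f"
    and comp_assoc: "f \<in> hom C W X \<Longrightarrow> g \<in> hom C X Y \<Longrightarrow> h \<in> hom C Y Z \<Longrightarrow>
      (h \<cdot> g) \<cdot> f = h \<cdot> (g \<cdot> f)"

definition mono :: "('o, 'a, 'r) category_data_scheme \<Rightarrow> 'a \<Rightarrow> bool" where
  "mono C f \<longleftrightarrow> f \<in> Arr C \<and>
    (\<forall>W. \<forall>g \<in> hom C W (Dom C f). \<forall>h \<in> hom C W (Dom C f).
      f \<cdot>\<^bsub>C\<^esub> g = f \<cdot>\<^bsub>C\<^esub> h \<longrightarrow> g = h)"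

definition epi :: "('o, 'a, 'r) category_data_scheme \<Rightarrow> 'a \<Rightarrow> bool" where
  "epi C f \<longleftrightarrow> f \<in> Arr C \<and>
    (\<forall>Z. \<forall>g \<in> hom C (Cod C f) Z. \<forall>h \<in> hom C (Cod C f) Z.
      g \<cdot>\<^bsub>C\<^esub> f = h \<cdot>\<^bsub>C\<^esub> f \<longrightarrow> g = h)"

definition iso :: "('o, 'a, 'r) category_data_scheme \<Rightarrow> 'a \<Rightarrow> bool" where
  "iso C f \<longleftrightarrow> f \<in> Arr C \<and>
    (\<exists>g \<in> hom C (Cod C f) (Dom C f).
      g \<cdot>\<^bsub>C\<^esub> f = Id C (Dom C f) \<and> f \<cdot>\<^bsub>C\<^esub> g = Id C (Cod C f))"

text \<open>A square is given by a span \<open>B \<leftarrow> A \<rightarrow> C'\<close> (\<open>f\<close> and \<open>g\<close>) followed by a cospan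
  \<open>B \<rightarrow> D \<leftarrow> C'\<close> (\<open>h\<close> and \<open>k\<close>); it commutes if \<open>h \<cdot> f = k \<cdot> g\<close>. Pushouts and pullbacks
  use the same argument order, so \<open>f\<close> is opposite to \<open>k\<close> and \<open>g\<close> is opposite to \<open>h\<close>.\<close>

definition comm_square ::
    "('o, 'a, 'r) category_data_scheme \<Rightarrow> 'a \<Rightarrow> 'a \<Rightarrow> 'a \<Rightarrow> 'a \<Rightarrow> bool" where
  "comm_square C f g h k \<longleftrightarrow>
    f \<in> Arr C \<and> g \<in> Arr C \<and> h \<in> Arr C \<and> k \<in> Arr C \<and>
    Dom C f = Dom C g \<and> Dom C h = Cod C f \<and> Dom C k = Cod C g \<and> Cod C h = Cod C k \<and>
    h \<cdot>\<^bsub>C\<^esub> f = k \<cdot>\<^bsub>C\<^esub> g"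

definition pushout ::
    "('o, 'a, 'r) category_data_scheme \<Rightarrow> 'a \<Rightarrow> 'a \<Rightarrow> 'a \<Rightarrow> 'a \<Rightarrow> bool" where
  "pushout C f g h k \<longleftrightarrow> comm_square C f g h k \<and>
    (\<forall>h' k'. comm_square C f g h' k' \<longrightarrow>
      (\<exists>!u. u \<in> hom C (Cod C h) (Cod C h') \<and> u \<cdot>\<^bsub>C\<^esub> h = h' \<and> u \<cdot>\<^bsub>C\<^esub> k = k'))"

definition pullback ::
    "('o, 'a, 'r) category_data_scheme \<Rightarrow> 'a \<Rightarrow> 'a \<Rightarrow> 'a \<Rightarrow> 'a \<Rightarrow> bool" where
  "pullback C f g h k \<longleftrightarrow> comm_square C f g h k \<and>
    (\<forall>f' g'. comm_square C f' g' h k \<longrightarrow>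
      (\<exists>!u. u \<in> hom C (Dom C f') (Dom C f) \<and> f \<cdot>\<^bsub>C\<^esub> u = f' \<and> g \<cdot>\<^bsub>C\<^esub> u = g'))"

text \<open>In the cube below the bottom face is \<open>f, g, h, k\<close>, the top face is \<open>f', g', h', k'\<close>,
  and \<open>a, b, c, d\<close> are the vertical morphisms, \<open>a\<close> being the one into the source corner.\<close>

definition M_van_Kampen ::
    "('o, 'a, 'r) category_data_scheme \<Rightarrow> 'a set \<Rightarrow> 'a \<Rightarrow> 'a \<Rightarrow> 'a \<Rightarrow> 'a \<Rightarrow> bool" where
  "M_van_Kampen C M f g h k \<longleftrightarrow> pushout C f g h k \<and>
    (\<forall>f' g' h' k' a b c d.
      comm_square C f' g' h' k' \<and>
      comm_square C b h' h d \<and> comm_square C c k' k d \<and>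
      pullback C a f' f b \<and> pullback C a g' g c \<and>
      b \<in> M \<and> c \<in> M \<and> d \<in> M \<longrightarrow>
      (pushout C f' g' h' k' \<longleftrightarrow> pullback C b h' h d \<and> pullback C c k' k d))"

locale M_adhesive_category = category C
  for C :: "('o, 'a, 'r) category_data_scheme" (structure) +
  fixes M :: "'a set"
  assumes M_mono: "m \<in> M \<Longrightarrow> mono C m"
    and M_iso: "iso C i \<Longrightarrow> i \<in> M"
    and M_comp: "f \<in> M \<Longrightarrow> g \<in> M \<Longrightarrow> Cod C f = Dom C g \<Longrightarrow> g \<cdot> f \<in> M"
    and M_decomp: "f \<in> Arr C \<Longrightarrow> g \<in> M \<Longrightarrow> Cod C f = Dom C g \<Longrightarrow> g \<cdot> f \<in> M \<Longrightarrow> f \<in> M"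
    and M_pushout_exists: "f \<in> Arr C \<Longrightarrow> g \<in> Arr C \<Longrightarrow> Dom C f = Dom C g \<Longrightarrow>
      f \<in> M \<or> g \<in> M \<Longrightarrow> \<exists>h k. pushout C f g h k"
    and M_pullback_exists: "h \<in> Arr C \<Longrightarrow> k \<in> Arr C \<Longrightarrow> Cod C h = Cod C k \<Longrightarrow>
      h \<in> M \<or> k \<in> M \<Longrightarrow> \<exists>f g. pullback C f g h k"
    and M_pushout_stable: "pushout C f g h k \<Longrightarrow> f \<in> M \<Longrightarrow> k \<in> M"
    and M_pullback_stable: "pullback C f g h k \<Longrightarrow> h \<in> M \<Longrightarrow> g \<in> M"
    and M_pushout_van_Kampen: "pushout C f g h k \<Longrightarrow> f \<in> M \<or> g \<in> M \<Longrightarrow> M_van_Kampen C M f g h k"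

definition epi_M_factorization ::
    "('o, 'a, 'r) category_data_scheme \<Rightarrow> 'a set \<Rightarrow> 'a \<Rightarrow> 'a \<Rightarrow> 'a \<Rightarrow> bool" where
  "epi_M_factorization C M f e m \<longleftrightarrow>
    epi C e \<and> m \<in> M \<and> Cod C e = Dom C m \<and> m \<cdot>\<^bsub>C\<^esub> e = f"

definition has_epi_M_factorizations ::
    "('o, 'a, 'r) category_data_scheme \<Rightarrow> 'a set \<Rightarrow> bool" where
  "has_epi_M_factorizations C M \<longleftrightarrow>
    (\<forall>f \<in> Arr C. (\<exists>e m. epi_M_factorization C M f e m) \<and>
      (\<forall>e m e' m'. epi_M_factorization C M f e m \<and> epi_M_factorization C M f e' m' \<longrightarrow>
        (\<exists>i \<in> hom C (Cod C e) (Cod C e'). iso C i \<and> i \<cdot>\<^bsub>C\<^esub> e = e' \<and> m' \<cdot>\<^bsub>C\<^esub> i = m)))"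

definition balanced :: "('o, 'a, 'r) category_data_scheme \<Rightarrow> bool" where
  "balanced C \<longleftrightarrow> (\<forall>f. mono C f \<and> epi C f \<longrightarrow> iso C f)"

definition strict_M_initial ::
    "('o, 'a, 'r) category_data_scheme \<Rightarrow> 'a set \<Rightarrow> 'o \<Rightarrow> bool" where
  "strict_M_initial C M Z \<longleftrightarrow> Z \<in> Obj C \<and>
    (\<forall>A \<in> Obj C. (\<exists>!i. i \<in> hom C Z A \<and> mono C i) \<and> (\<forall>i \<in> hom C Z A. mono C i \<longrightarrow> i \<in> M)) \<and>
    (\<forall>Y. \<forall>f \<in> hom C Y Z. iso C f)"

definition has_M_effective_unions ::
    "('o, 'a, 'r) category_data_scheme \<Rightarrow> 'a set \<Rightarrow> bool" where
  "has_M_effective_unions C M \<longleftrightarrow>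
    (\<forall>b' c' p q b c u.
      b' \<in> M \<and> c' \<in> M \<and> pushout C b' c' p q \<and>
      b \<in> M \<and> c \<in> M \<and> pullback C b' c' b c \<and>
      u \<in> hom C (Cod C p) (Cod C b) \<and> u \<cdot>\<^bsub>C\<^esub> p = b \<and> u \<cdot>\<^bsub>C\<^esub> q = c \<longrightarrow> u \<in> M)"

locale M_adhesive_with_effective_unions = M_adhesive_category C M
  for C :: "('o, 'a, 'r) category_data_scheme" (structure) and M :: "'a set" +
  assumes epi_M_factorizations: "has_epi_M_factorizations C M"
    and balanced: "balanced C"
    and strict_M_initial_object: "\<exists>Z. strict_M_initial C M Z"
    and M_effective_unions: "has_M_effective_unions C M"

end

theory Submission
  imports Defs
begin

text \<open>A morphism out of a pushout is an epimorphism iff its two restrictions are jointly epic, so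
  whether \<open>e\<close> is an epimorphism depends on \<open>e1\<close> and \<open>e2\<close> only, and not on the span \<open>a1, a2\<close>. Hence
  \<open>e\<close> is an epimorphism iff the morphism \<open>u\<close> from the pushout of \<open>b1, b2\<close> to \<open>E\<close> is one. By
  effective unions \<open>u\<close> is a monomorphism, so if it is epi then balancedness makes it an
  isomorphism.\<close>

lemma comm_square_sym: "comm_square C f g h k \<Longrightarrow> comm_square C g f k h"
  by (simp add: comm_square_def)

text \<open>Stability of \<open>M\<close> under pullback speaks of only one pair of opposite sides;
  the mirrored square covers the other pair.\<close>

lemma pullback_sym:
  assumes "pullback C f g h k"
  shows "pullback C g f k h"
  unfolding pullback_def
proof (intro conjI allI impI)
  show "comm_square C g f k h"
    using assms by (simp add: pullback_def comm_square_sym)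
  fix f' g' assume "comm_square C f' g' k h"
  then have sq: "comm_square C g' f' h k"
    by (rule comm_square_sym)
  \<comment> \<open>The mediating morphism is typed by the first leg of each span, so exchanging
    legs also requires equal domains.\<close>
  have dom: "Dom C f' = Dom C g'" "Dom C f = Dom C g"
    using assms sq by (simp_all only: comm_square_def pullback_def)
  have "\<exists>!u. u \<in> hom C (Dom C g') (Dom C f) \<and> f \<cdot>\<^bsub>C\<^esub> u = g' \<and> g \<cdot>\<^bsub>C\<^esub> u = f'"
    using assms sq unfolding pullback_def by blast
  then show "\<exists>!u. u \<in> hom C (Dom C f') (Dom C g) \<and> g \<cdot>\<^bsub>C\<^esub> u = f' \<and> f \<cdot>\<^bsub>C\<^esub> u = g'"
    by (simp only: dom conj_commute)
qed

text \<open>Meant for cospans, so the codomain of \<open>h\<close> also serves for \<open>k\<close>.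
  No span occurs in it, which allows cospans arising from different spans to be compared.\<close>

definition jointly_epic :: "('o, 'a, 'r) category_data_scheme \<Rightarrow> 'a \<Rightarrow> 'a \<Rightarrow> bool" where
  "jointly_epic C h k \<longleftrightarrow>
    (\<forall>Z. \<forall>u \<in> hom C (Cod C h) Z. \<forall>v \<in> hom C (Cod C h) Z.
      u \<cdot>\<^bsub>C\<^esub> h = v \<cdot>\<^bsub>C\<^esub> h \<longrightarrow> u \<cdot>\<^bsub>C\<^esub> k = v \<cdot>\<^bsub>C\<^esub> k \<longrightarrow> u = v)"

context category
begin

lemma comm_square_postcomp:
  assumes sq: "comm_square C f g h k" and u: "u \<in> hom C (Cod C h) Z"
  shows "comm_square C f g (u \<cdot> h) (u \<cdot> k)"
proof -
  have f: "f \<in> hom C (Dom C f) (Dom C h)" and g: "g \<in> hom C (Dom C f) (Dom C k)"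
    and h: "h \<in> hom C (Dom C h) (Cod C h)" and k: "k \<in> hom C (Dom C k) (Cod C h)"
    and eq: "h \<cdot> f = k \<cdot> g"
    using sq by (auto simp: comm_square_def hom_def)
  have "(u \<cdot> h) \<cdot> f = (u \<cdot> k) \<cdot> g"
    using comp_assoc[OF f h u] comp_assoc[OF g k u] eq by simp
  then show ?thesis
    using f g comp_hom[OF h u] comp_hom[OF k u] by (simp add: comm_square_def hom_def)
qed

text \<open>This is the uniqueness half of the universal property, applied to the cocone
  \<open>u \<cdot> h\<close>, \<open>u \<cdot> k\<close>, through which both \<open>u\<close> and
  \<open>v\<close> mediate.\<close>

lemma pushout_jointly_epic:
  assumes "pushout C f g h k"
  shows "jointly_epic C h k"
  unfolding jointly_epic_def
proof (intro allI ballI impI)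
  fix Z u v
  assume u: "u \<in> hom C (Cod C h) Z" and v: "v \<in> hom C (Cod C h) Z"
    and eq: "u \<cdot> h = v \<cdot> h" "u \<cdot> k = v \<cdot> k"
  have sq: "comm_square C f g h k"
    using assms by (simp add: pushout_def)
  then have "h \<in> hom C (Dom C h) (Cod C h)"
    by (simp add: comm_square_def hom_def)
  then have Z: "Cod C (u \<cdot> h) = Z"
    using comp_hom u by (simp add: hom_def)
  have "\<exists>!w. w \<in> hom C (Cod C h) (Cod C (u \<cdot> h)) \<and> w \<cdot> h = u \<cdot> h \<and> w \<cdot> k = u \<cdot> k"
    using assms comm_square_postcomp[OF sq u] unfolding pushout_def by blast
  then show "u = v"
    unfolding Z using u v eq by auto
qed

text \<open>Since \<open>h\<close> and \<open>k\<close> are jointly epic,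
  \<open>u \<cdot> e = v \<cdot> e\<close> can be tested after composing with each of them.\<close>

lemma epi_iff_jointly_epic:
  assumes po: "pushout C f g h k" and e: "e \<in> hom C (Cod C h) E"
  shows "epi C e \<longleftrightarrow> jointly_epic C (e \<cdot> h) (e \<cdot> k)"
proof -
  have h: "h \<in> hom C (Dom C h) (Cod C h)" and k: "k \<in> hom C (Dom C k) (Cod C h)"
    using po by (auto simp: pushout_def comm_square_def hom_def)
  have cod: "Cod C e = E" "Cod C (e \<cdot> h) = E" and arr: "e \<in> Arr C"
    using e comp_hom[OF h e] by (simp_all add: hom_def)
  have "(u \<cdot> (e \<cdot> h) = v \<cdot> (e \<cdot> h) \<and> u \<cdot> (e \<cdot> k) = v \<cdot> (e \<cdot> k)) \<longleftrightarrow> u \<cdot> e = v \<cdot> e"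
    if u: "u \<in> hom C E Z" and v: "v \<in> hom C E Z" for u v Z
  proof -
    have "u \<cdot> e = v \<cdot> e \<longleftrightarrow> (u \<cdot> e) \<cdot> h = (v \<cdot> e) \<cdot> h \<and> (u \<cdot> e) \<cdot> k = (v \<cdot> e) \<cdot> k"
      using pushout_jointly_epic[OF po, unfolded jointly_epic_def, rule_format,
          OF comp_hom[OF e u] comp_hom[OF e v]] by auto
    then show ?thesis
      using comp_assoc[OF h e u] comp_assoc[OF h e v] comp_assoc[OF k e u] comp_assoc[OF k e v]
      by simp
  qed
  then show ?thesis
    using arr unfolding epi_def jointly_epic_def cod by blast
qed

text \<open>A mediating morphism \<open>u\<close> for the old cospan becomes
  \<open>u \<cdot> j\<close> for the new one, where \<open>j\<close> is the inverse of
  \<open>i\<close>.\<close>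

lemma pushout_comp_iso:
  assumes po: "pushout C f g h k" and i: "i \<in> hom C (Cod C h) E" and iso: "iso C i"
  shows "pushout C f g (i \<cdot> h) (i \<cdot> k)"
  unfolding pushout_def
proof (intro conjI allI impI)
  have sq: "comm_square C f g h k"
    using po by (simp add: pushout_def)
  then have h: "h \<in> hom C (Dom C h) (Cod C h)" and k: "k \<in> hom C (Dom C k) (Cod C h)"
    by (auto simp: comm_square_def hom_def)
  have cod: "Cod C (i \<cdot> h) = E"
    using comp_hom[OF h i] by (simp add: hom_def)
  obtain j where j: "j \<in> hom C E (Cod C h)" "j \<cdot> i = Id C (Cod C h)" "i \<cdot> j = Id C E"
    using iso i by (auto simp: iso_def hom_def)
  show "comm_square C f g (i \<cdot> h) (i \<cdot> k)"
    using sq i by (rule comm_square_postcomp)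
  fix h' k' assume "comm_square C f g h' k'"
  then have "\<exists>!u. u \<in> hom C (Cod C h) (Cod C h') \<and> u \<cdot> h = h' \<and> u \<cdot> k = k'"
    using po unfolding pushout_def by blast
  then obtain u where u: "u \<in> hom C (Cod C h) (Cod C h')" "u \<cdot> h = h'" "u \<cdot> k = k'"
    and uniq: "\<And>v. v \<in> hom C (Cod C h) (Cod C h') \<Longrightarrow> v \<cdot> h = h' \<Longrightarrow> v \<cdot> k = k' \<Longrightarrow> v = u"
    by (elim ex1E) blast
  have uj: "u \<cdot> j \<in> hom C E (Cod C h')"
    using j(1) u(1) by (rule comp_hom)
  have uji: "(u \<cdot> j) \<cdot> i = u"
    using comp_assoc[OF i j(1) u(1)] j(2) comp_id_right[OF u(1)] by simp
  show "\<exists>!v. v \<in> hom C (Cod C (i \<cdot> h)) (Cod C h') \<and> v \<cdot> (i \<cdot> h) = h' \<and> v \<cdot> (i \<cdot> k) = k'"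
    unfolding cod
  proof (rule ex1I[of _ "u \<cdot> j"], intro conjI)
    show "u \<cdot> j \<in> hom C E (Cod C h')" by (rule uj)
    show "(u \<cdot> j) \<cdot> (i \<cdot> h) = h'" "(u \<cdot> j) \<cdot> (i \<cdot> k) = k'"
      using comp_assoc[OF h i uj] comp_assoc[OF k i uj] uji u by simp_all
  next
    fix v assume v: "v \<in> hom C E (Cod C h') \<and> v \<cdot> (i \<cdot> h) = h' \<and> v \<cdot> (i \<cdot> k) = k'"
    then have vE: "v \<in> hom C E (Cod C h')" by simp
    \<comment> \<open>By associativity \<open>v \<cdot> i\<close> mediates from the old cospan, so
      it must be \<open>u\<close>; composing with \<open>j\<close> then recovers
      \<open>v\<close>.\<close>
    have "v \<cdot> i = u"
      using v comp_assoc[OF h i vE] comp_assoc[OF k i vE] comp_hom[OF i vE] by (intro uniq) simp_all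
    then show "v = u \<cdot> j"
      using comp_assoc[OF j(1) i vE] j(3) comp_id_right[OF vE] by simp
  qed
qed

end

lemma (in M_adhesive_with_effective_unions) jointly_epic_pullback_is_pushout:
  assumes pb: "pullback C b1 b2 e1 e2" and M: "e1 \<in> M" "e2 \<in> M"
    and epic: "jointly_epic C e1 e2"
  shows "pushout C b1 b2 e1 e2"
proof -
  have b: "b1 \<in> M" "b2 \<in> M"
    using M_pullback_stable[OF pullback_sym[OF pb] M(2)] M_pullback_stable[OF pb M(1)] .
  have sq: "comm_square C b1 b2 e1 e2"
    using pb by (simp add: pullback_def)
  \<comment> \<open>The true pushout of the pullback span is compared with the given cospan through
    \<open>u\<close>.\<close>
  then obtain p q where po: "pushout C b1 b2 p q"
    using M_pushout_exists b unfolding comm_square_def by blast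
  then obtain u where u: "u \<in> hom C (Cod C p) (Cod C e1)" "u \<cdot> p = e1" "u \<cdot> q = e2"
    using sq unfolding pushout_def by blast
  have "u \<in> M"
    using M_effective_unions b po M pb u unfolding has_M_effective_unions_def by blast
  \<comment> \<open>The legs \<open>p\<close> and \<open>q\<close> compose with \<open>u\<close> to
    \<open>e1\<close> and \<open>e2\<close>, so joint epicness of the latter transfers to
    \<open>u\<close>.\<close>
  moreover have "epi C u"
    using epi_iff_jointly_epic[OF po u(1)] u epic by simp
  ultimately have "iso C u"
    using balanced M_mono unfolding balanced_def by blast
  then show ?thesis
    using pushout_comp_iso[OF po u(1)] u by simp
qed

theorem theorem3p4:
  fixes C :: "('o, 'a) category_data" (structure)
    and M :: "'a set"
    and A B1 B2 D E X :: 'o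
    and a1 a2 d1 d2 e1 e2 e b1 b2 x :: 'a
  assumes "M_adhesive_with_effective_unions C M"
    and "a1 \<in> hom C A B1" and "a1 \<in> M"
    and "a2 \<in> hom C A B2" and "a2 \<in> M"
    and "d1 \<in> hom C B1 D" and "d2 \<in> hom C B2 D"
    and "pushout C a1 a2 d1 d2"
    and "e1 \<in> hom C B1 E" and "e1 \<in> M"
    and "e2 \<in> hom C B2 E" and "e2 \<in> M"
    and "e1 \<cdot> a1 = e2 \<cdot> a2"
    and "e \<in> hom C D E" and "e \<cdot> d1 = e1" and "e \<cdot> d2 = e2"
    and "b1 \<in> hom C X B1" and "b2 \<in> hom C X B2"
    and "pullback C b1 b2 e1 e2"
    and "x \<in> hom C A X" and "b1 \<cdot> x = a1" and "b2 \<cdot> x = a2"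
  shows "epi C e \<longleftrightarrow> pushout C b1 b2 e1 e2"
proof -
  interpret M_adhesive_with_effective_unions C M by fact
  have "e \<in> hom C (Cod C d1) E"
    using \<open>d1 \<in> hom C B1 D\<close> \<open>e \<in> hom C D E\<close> by (simp add: hom_def)
  from epi_iff_jointly_epic[OF \<open>pushout C a1 a2 d1 d2\<close> this]
  have "epi C e \<longleftrightarrow> jointly_epic C e1 e2"
    by (simp only: \<open>e \<cdot> d1 = e1\<close> \<open>e \<cdot> d2 = e2\<close>)
  \<comment> \<open>Left to right is the effective union argument; right to left, the legs of any
    pushout are jointly epic.\<close>
  also have "\<dots> \<longleftrightarrow> pushout C b1 b2 e1 e2"
    using jointly_epic_pullback_is_pushout[OF \<open>pullback C b1 b2 e1 e2\<close> \<open>e1 \<in> M\<close> \<open>e2 \<in> M\<close>]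
      pushout_jointly_epic by blast
  finally show ?thesis .
qed

end
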